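(* Let $f:I\subseteq\mathbb{R}\to\mathbb{R}$ be a differentiable mapping on $I^{\circ}$ such that $f'\in L[a,b]$, where $a,b\in I^{\circ}$ with $a<b$. If $|f'|^{q}$ is a $P$-function on $[a,b]$, $q>1$, and $\frac1p+\frac1q=1$, then $$\left|\frac16\left[f(a)+4f\left(\frac{a+b}{2}\right)+f(b)\right]-\frac{1}{b-a}\int_{a}^{b}f(x)\,dx\right|\leq\frac{b-a}{12}\left(\frac{1+2^{p+1}}{3(p+1)}\right)^{\frac1p}\left\{\left(\left|f'\left(\tfrac{a+b}{2}\right)\right|^{q}+|f'(a)|^{q}\right)^{\frac1q}+\left(\left|f'\left(\tfrac{a+b}{2}\right)\right|^{q}+|f'(b)|^{q}\right)^{\frac1q}\right\}.$$
   Context: $I$ is an interval of real numbers and $I^{\circ}$ is its interior. $L[a,b]$ denotes the integrable functions on $[a,b]$. A function $g:J\to\mathbb{R}$ on an interval $J$ is a $P$-function if $g$ is non-negative and $g(tx+(1-t)y)\leq g(x)+g(y)$ for all $x,y\in J$ and $t\in[0,1]$. *)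

theory Defs
  imports "HOL-Analysis.Analysis"
begin

definition P_function_on :: "real set \<Rightarrow> (real \<Rightarrow> real) \<Rightarrow> bool" where
  "P_function_on J g \<longleftrightarrow>
     is_interval J \<and>
     (\<forall>x\<in>J. 0 \<le> g x) \<and>
     (\<forall>x\<in>J. \<forall>y\<in>J. \<forall>t\<in>{0..1}. g (t * x + (1 - t) * y) \<le> g x + g y)"

end

theory Submission
  imports Defs
begin

text \<open>
  The P-function hypothesis is a supremum bound in disguise: every point between \<open>x\<close> and \<open>y\<close> is a
  convex combination of them, so \<open>\<bar>f'\<bar> \<le> (\<bar>f' x\<bar>\<^sup>q + \<bar>f' y\<bar>\<^sup>q) powr (1 / q)\<close> throughout the segment
  (lemma \<open>P_function_powr_imp_bound\<close>).  With \<open>m = (a + b) / 2\<close>, this makes \<open>f\<close> Lipschitz on \<open>{a..m}\<close>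
  with the constant \<open>A = (\<bar>f' m\<bar>\<^sup>q + \<bar>f' a\<bar>\<^sup>q) powr (1 / q)\<close>, and on \<open>{m..b}\<close> with the analogous
  constant \<open>B\<close>.

  Simpson's rule is a Riemann sum for the division of \<open>{a..b}\<close> at \<open>a + h\<close>, \<open>m\<close> and \<open>b - h\<close>, where
  \<open>h = (b - a) / 6\<close>, with the values of \<open>f\<close> taken at \<open>a\<close>, \<open>m\<close>, \<open>m\<close> and \<open>b\<close>.  Every sample is an end
  of its piece, and a piece of length \<open>l\<close> on which \<open>f\<close> has Lipschitz constant \<open>L\<close> contributes an
  error of at most \<open>L * l\<^sup>2 / 2\<close>.  On either half the pieces have lengths \<open>h\<close> and \<open>2 * h\<close>, so the
  total error is at most \<open>5 / 2 * h\<^sup>2 * (A + B)\<close>, which after division by \<open>b - a\<close> is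
  \<open>(b - a) / 12 * (5 / 6) * (A + B)\<close> (lemma \<open>simpson_lipschitz\<close>).

  The claim has \<open>((1 + 2 powr (p + 1)) / (3 * (p + 1))) powr (1 / p)\<close> in the place of \<open>5 / 6\<close>.  These
  two numbers are the \<open>p\<close>-norm and the 1-norm of the function \<open>t \<mapsto> \<bar>3 * t - 1\<bar>\<close> on the unit
  interval, so the latter is the smaller one (lemma \<open>five_sixths_le_powr\<close>).
\<close>

section \<open>Simpson's rule for Lipschitz functions\<close>

lemma left_endpoint_rule_lipschitz:
  fixes f :: "real \<Rightarrow> real"
  assumes "L-lipschitz_on {u..v} f" "u \<le> v"
  shows "\<bar>integral {u..v} f - (v - u) * f u\<bar> \<le> L * (v - u)\<^sup>2 / 2"
proof -
  have f: "f integrable_on {u..v}"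
    by (intro integrable_continuous_real lipschitz_on_continuous_on[OF assms(1)])
  have c: "((\<lambda>x. f u) has_integral (v - u) * f u) {u..v}"
    using has_integral_const_real[of "f u" u v] assms(2) by simp
  have d: "((\<lambda>x. f x - f u) has_integral (integral {u..v} f - (v - u) * f u)) {u..v}"
    by (intro has_integral_diff integrable_integral f c)
  have g: "((\<lambda>x. L * (x - u)) has_integral (L * (v - u)\<^sup>2 / 2 - L * (u - u)\<^sup>2 / 2)) {u..v}"
    using assms(2)
    by (intro fundamental_theorem_of_calculus)
       (auto intro!: derivative_eq_intros simp: has_real_derivative_iff_has_vector_derivative[symmetric])
  have "norm (f x - f u) \<le> L * (x - u)" if "x \<in> {u..v}" for x
    using lipschitz_onD[OF assms(1) that, of u] that by (simp add: dist_real_def)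
  then have "norm (integral {u..v} (\<lambda>x. f x - f u)) \<le> integral {u..v} (\<lambda>x. L * (x - u))"
    using d g by (intro integral_norm_bound_integral) auto
  then show ?thesis
    unfolding integral_unique[OF d] integral_unique[OF g] by simp
qed

lemma right_endpoint_rule_lipschitz:
  fixes f :: "real \<Rightarrow> real"
  assumes "L-lipschitz_on {u..v} f" "u \<le> v"
  shows "\<bar>integral {u..v} f - (v - u) * f v\<bar> \<le> L * (v - u)\<^sup>2 / 2"
proof -
  have "L-lipschitz_on {-v..-u} (\<lambda>x. f (- x))"
  proof (rule lipschitz_onI)
    fix x y assume "x \<in> {-v..-u}" "y \<in> {-v..-u}"
    then show "dist (f (- x)) (f (- y)) \<le> L * dist x y"
      using lipschitz_onD[OF assms(1), of "- x" "- y"] by (simp add: dist_minus)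
  qed (rule lipschitz_on_nonneg[OF assms(1)])
  from left_endpoint_rule_lipschitz[OF this] assms(2) show ?thesis
    by (simp add: add.commute)
qed

text \<open>
  Separate constants for the two halves matter: the two bounds on the derivative in the
  final estimate are added, not merged into their maximum.
\<close>

lemma simpson_lipschitz:
  fixes f :: "real \<Rightarrow> real"
  assumes "a < b"
    and A: "A-lipschitz_on {a..(a + b) / 2} f" and B: "B-lipschitz_on {(a + b) / 2..b} f"
  shows "\<bar>1 / 6 * (f a + 4 * f ((a + b) / 2) + f b) - 1 / (b - a) * integral {a..b} f\<bar>
    \<le> (b - a) / 12 * (5 / 6) * (A + B)"
proof -
  define m h where "m = (a + b) / 2" and "h = (b - a) / 6"
  have h: "h > 0" "m = a + 3 * h" "b = a + 6 * h"
    using assms(1) by (simp_all add: m_def h_def field_simps)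
  note A = A[folded m_def] and B = B[folded m_def]
  have 1: "\<bar>integral {a..a+h} f - h * f a\<bar> \<le> A * h\<^sup>2 / 2"
    using left_endpoint_rule_lipschitz[OF lipschitz_on_subset[OF A], of a "a+h"] h by simp
  have 2: "\<bar>integral {a+h..m} f - 2 * h * f m\<bar> \<le> 2 * A * h\<^sup>2"
    using right_endpoint_rule_lipschitz[OF lipschitz_on_subset[OF A], of "a+h" m] h
    by (simp add: power2_eq_square)
  have 3: "\<bar>integral {m..m+2*h} f - 2 * h * f m\<bar> \<le> 2 * B * h\<^sup>2"
    using left_endpoint_rule_lipschitz[OF lipschitz_on_subset[OF B], of m "m+2*h"] h
    by (simp add: power2_eq_square)
  have 4: "\<bar>integral {m+2*h..b} f - h * f b\<bar> \<le> B * h\<^sup>2 / 2"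
    using right_endpoint_rule_lipschitz[OF lipschitz_on_subset[OF B], of "m+2*h" b] h by simp
  have iA: "f integrable_on {a..m}" and iB: "f integrable_on {m..b}"
    by (intro integrable_continuous_real lipschitz_on_continuous_on[OF A]
        lipschitz_on_continuous_on[OF B])+
  have iab: "f integrable_on {a..b}"
    using h by (intro Henstock_Kurzweil_Integration.integrable_combine[OF _ _ iA iB]) auto
  have "integral {a..b} f = integral {a..a+h} f + integral {a+h..m} f
      + integral {m..m+2*h} f + integral {m+2*h..b} f"
    using Henstock_Kurzweil_Integration.integral_combine[OF _ _ iab, of m]
      Henstock_Kurzweil_Integration.integral_combine[OF _ _ iA, of "a+h"]
      Henstock_Kurzweil_Integration.integral_combine[OF _ _ iB, of "m+2*h"] h by simp
  with 1 2 3 4 have "\<bar>h * (f a + 4 * f m + f b) - integral {a..b} f\<bar> \<le> 5 / 2 * (A + B) * h\<^sup>2"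
    unfolding abs_le_iff by (auto simp: algebra_simps)
  then have "\<bar>h * (f a + 4 * f m + f b) - integral {a..b} f\<bar> / (6 * h)
      \<le> 5 / 2 * (A + B) * h\<^sup>2 / (6 * h)"
    using h(1) by (intro divide_right_mono) auto
  also have "\<bar>h * (f a + 4 * f m + f b) - integral {a..b} f\<bar> / (6 * h)
      = \<bar>1 / 6 * (f a + 4 * f m + f b) - 1 / (6 * h) * integral {a..b} f\<bar>"
  proof -
    have "(h * y - J) / (6 * h) = 1 / 6 * y - 1 / (6 * h) * J" for y J
      using h(1) by (simp add: field_simps)
    from this[of "f a + 4 * f m + f b" "integral {a..b} f", symmetric] h(1) show ?thesis
      by simp
  qed
  also have "5 / 2 * (A + B) * h\<^sup>2 / (6 * h) = h / 2 * (5 / 6) * (A + B)"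
    using h(1) by (simp add: power2_eq_square)
  finally show ?thesis
    using h(3) by (simp add: m_def)
qed

section \<open>The derivative bound from the P-function property\<close>

lemma P_function_powr_imp_bound:
  assumes P: "P_function_on J (\<lambda>x. \<bar>g x\<bar> powr q)" and "q > 0"
    and "x \<in> J" "y \<in> J" and z: "z \<in> closed_segment x y"
  shows "\<bar>g z\<bar> \<le> (\<bar>g x\<bar> powr q + \<bar>g y\<bar> powr q) powr (1 / q)"
proof -
  obtain t where t: "0 \<le> t" "t \<le> 1" "z = (1 - t) * x + t * y"
    using z by (auto simp: closed_segment_def)
  have "\<bar>g (t * y + (1 - t) * x)\<bar> powr q \<le> \<bar>g y\<bar> powr q + \<bar>g x\<bar> powr q"
    using P assms(3,4) t(1,2) unfolding P_function_on_def by auto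
  then have "\<bar>g z\<bar> powr q \<le> \<bar>g x\<bar> powr q + \<bar>g y\<bar> powr q"
    by (simp add: t(3) add.commute)
  then have "(\<bar>g z\<bar> powr q) powr (1 / q) \<le> (\<bar>g x\<bar> powr q + \<bar>g y\<bar> powr q) powr (1 / q)"
    using assms(2) by (intro powr_mono2) auto
  then show ?thesis
    using assms(2) by (simp add: powr_powr)
qed

lemma bounded_deriv_imp_lipschitz_on:
  fixes f :: "real \<Rightarrow> real"
  assumes "convex X" "0 \<le> M"
    and "\<And>x. x \<in> X \<Longrightarrow> (f has_real_derivative f' x) (at x)"
    and "\<And>x. x \<in> X \<Longrightarrow> \<bar>f' x\<bar> \<le> M"
  shows "M-lipschitz_on X f"
proof (rule lipschitz_onI)
  fix x y assume "x \<in> X" "y \<in> X"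
  then have "norm (f x - f y) \<le> M * norm (x - y)"
    using assms by (intro field_differentiable_bound[of X f f'])
      (auto intro: has_field_derivative_at_within)
  then show "dist (f x) (f y) \<le> M * dist x y"
    by (simp add: dist_norm)
qed (rule assms(2))

section \<open>Comparison of the constants\<close>

lemma powr_ge_tangent:
  fixes p c x :: real
  assumes "p \<ge> 1" "c > 0" "x \<ge> 0"
  shows "c powr p * (1 + p * (x / c - 1)) \<le> x powr p"
proof (cases "x = 0")
  case True
  then show ?thesis
    using assms by (simp add: mult_nonneg_nonpos)
next
  case False
  have "x powr p - c powr p \<ge> (p * c powr (p - 1)) * (x - c)"
    using assms False
    by (intro convex_on_imp_above_tangent[OF powr_convex])
       (auto intro!: derivative_eq_intros simp: interior_open)
  moreover have "p * c powr (p - 1) * (x - c) = c powr p * (p * (x / c - 1))"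
    using assms(2) by (simp add: powr_diff field_simps)
  ultimately show ?thesis
    by (simp add: algebra_simps)
qed

lemma powr_ge_tangent_integrated:
  fixes p c T :: real
  assumes "p \<ge> 1" "c > 0" "T \<ge> 0"
  shows "c powr p * (T + p * (T\<^sup>2 / (2 * c) - T)) \<le> T powr (p + 1) / (p + 1)"
proof -
  let ?F = "\<lambda>x. c powr p * (x + p * (x\<^sup>2 / (2 * c) - x))"
  have "((\<lambda>x. c powr p * (1 + p * (x / c - 1))) has_integral (?F T - ?F 0)) {0..T}"
    using assms
    by (intro fundamental_theorem_of_calculus)
       (auto intro!: derivative_eq_intros simp: has_real_derivative_iff_has_vector_derivative[symmetric])
  moreover have "((\<lambda>x. x powr p) has_integral (T powr (p + 1) / (p + 1))) {0..T}"
    using assms by (intro has_integral_powr_from_0) auto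
  ultimately have "?F T - ?F 0 \<le> T powr (p + 1) / (p + 1)"
    by (rule has_integral_le) (use assms powr_ge_tangent in auto)
  then show ?thesis
    by simp
qed

text \<open>
  As \<open>t\<close> runs through the unit interval, \<open>\<bar>3 * t - 1\<bar>\<close> runs through \<open>{0..1}\<close> and \<open>{0..2}\<close> with
  density 1/3, so its \<open>p\<close>-th moment is a third of the sum of the integrals of \<open>x powr p\<close> over these two
  intervals.  Jensen's inequality for this distribution, whose mean is \<open>5 / 6\<close>, amounts to integrating
  the tangent at the mean.
\<close>

lemma five_sixths_le_powr:
  fixes p :: real
  assumes "p \<ge> 1"
  shows "5 / 6 \<le> ((1 + 2 powr (p + 1)) / (3 * (p + 1))) powr (1 / p)"
proof -
  let ?c = "5 / 6 :: real"
  have "?c powr p * (1 + p * (1\<^sup>2 / (2 * ?c) - 1)) + ?c powr p * (2 + p * (2\<^sup>2 / (2 * ?c) - 2))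
      \<le> 1 powr (p + 1) / (p + 1) + 2 powr (p + 1) / (p + 1)"
    using assms by (intro add_mono powr_ge_tangent_integrated) auto
  \<comment> \<open>The terms with the factor \<open>p\<close> cancel because the tangent is taken at the mean.\<close>
  moreover have "?c powr p * (1 + p * (1\<^sup>2 / (2 * ?c) - 1)) + ?c powr p * (2 + p * (2\<^sup>2 / (2 * ?c) - 2))
      = 3 * ?c powr p"
    by (simp add: algebra_simps)
  ultimately have "?c powr p \<le> (1 + 2 powr (p + 1)) / (3 * (p + 1))"
    using assms by (simp add: field_simps)
  then have "(?c powr p) powr (1 / p) \<le> ((1 + 2 powr (p + 1)) / (3 * (p + 1))) powr (1 / p)"
    using assms by (intro powr_mono2) auto
  then show ?thesis
    using assms by (simp add: powr_powr)
qed

section \<open>Simpson's inequality for P-functions\<close>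

theorem corollary5:
  fixes f :: "real \<Rightarrow> real" and I :: "real set" and a b p q :: real
  assumes "is_interval I"
    and "f differentiable_on interior I"
    and "a \<in> interior I" and "b \<in> interior I" and "a < b"
    and "deriv f absolutely_integrable_on {a..b}"
    and "P_function_on {a..b} (\<lambda>x. \<bar>deriv f x\<bar> powr q)"
    and "q > 1" and "1 / p + 1 / q = 1"
  shows "\<bar>1 / 6 * (f a + 4 * f ((a + b) / 2) + f b) - 1 / (b - a) * integral {a..b} f\<bar>
    \<le> (b - a) / 12 * ((1 + 2 powr (p + 1)) / (3 * (p + 1))) powr (1 / p) *
       ((\<bar>deriv f ((a + b) / 2)\<bar> powr q + \<bar>deriv f a\<bar> powr q) powr (1 / q) +
        (\<bar>deriv f ((a + b) / 2)\<bar> powr q + \<bar>deriv f b\<bar> powr q) powr (1 / q))"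
proof -
  define m where "m = (a + b) / 2"
  define A where "A = (\<bar>deriv f m\<bar> powr q + \<bar>deriv f a\<bar> powr q) powr (1 / q)"
  define B where "B = (\<bar>deriv f m\<bar> powr q + \<bar>deriv f b\<bar> powr q) powr (1 / q)"
  have m: "a < m" "m < b"
    using \<open>a < b\<close> by (simp_all add: m_def)
  have nonneg: "0 \<le> A" "0 \<le> B"
    by (simp_all add: A_def B_def)
  have "is_interval (interior I)"
    using assms(1) by (simp add: is_interval_convex_1 convex_interior)
  then have sub: "{a..b} \<subseteq> interior I"
    using assms(3,4) by (meson atLeastAtMost_iff mem_is_interval_1_I subsetI)
  have der: "(f has_real_derivative deriv f x) (at x)" if "x \<in> {a..b}" for x
    using assms(2) sub that
    by (metis DERIV_deriv_iff_real_differentiable differentiable_on_eq_differentiable_at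
        open_interior subsetD)
  have "\<bar>deriv f x\<bar> \<le> A" if "x \<in> {a..m}" for x
    unfolding A_def using assms(7,8) m that
    by (intro P_function_powr_imp_bound[where J = "{a..b}"])
       (auto simp: closed_segment_eq_real_ivl)
  then have A: "A-lipschitz_on {a..m} f"
    using m nonneg(1) by (intro bounded_deriv_imp_lipschitz_on[where f' = "deriv f"] der) auto
  have "\<bar>deriv f x\<bar> \<le> B" if "x \<in> {m..b}" for x
    unfolding B_def using assms(7,8) m that
    by (intro P_function_powr_imp_bound[where J = "{a..b}"])
       (auto simp: closed_segment_eq_real_ivl)
  then have B: "B-lipschitz_on {m..b} f"
    using m nonneg(2) by (intro bounded_deriv_imp_lipschitz_on[where f' = "deriv f"] der) auto
  have "p \<ge> 1"
  proof -
    have "0 < 1 / q" "1 / q < 1"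
      using assms(8) by simp_all
    then have "0 < 1 / p" "1 / p < 1"
      using assms(9) by linarith+
    then show ?thesis
      by (simp add: field_simps split: if_splits)
  qed
  have "\<bar>1 / 6 * (f a + 4 * f m + f b) - 1 / (b - a) * integral {a..b} f\<bar>
      \<le> (b - a) / 12 * (5 / 6) * (A + B)"
    using simpson_lipschitz[OF \<open>a < b\<close>] A B unfolding m_def by blast
  also have "\<dots> \<le> (b - a) / 12 * ((1 + 2 powr (p + 1)) / (3 * (p + 1))) powr (1 / p) * (A + B)"
    using \<open>a < b\<close> nonneg
    by (intro mult_right_mono mult_left_mono five_sixths_le_powr \<open>p \<ge> 1\<close>) auto
  finally show ?thesis
    by (simp add: m_def A_def B_def)
qed

end
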